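(* If $n\geq 3$ and $0<\varepsilon<\frac{\pi}{n-2}$, then \[F_2(\varepsilon,n)\leq \frac{1}{\cos \frac{(n-2)\varepsilon}{2}}-1.\]
   Context: A Steiner topology for $n$ terminals is a (graph-theoretic) tree $\mathcal{T}$ with $n$ special vertices $t_1,\dots,t_n$, called terminals, all of degree at most $3$, and all other vertices, called Steiner points, of degree exactly $3$. It is full if all terminals have degree $1$. Given a family $p_1,\dots,p_n$ of points in $\mathbb{R}^d$ (repetitions allowed), a Steiner tree with topology $\mathcal{T}$ on these points is a representation of $\mathcal{T}$ in $\mathbb{R}^d$ in which $t_i$ is represented by $p_i$, each Steiner point by an arbitrary point of $\mathbb{R}^d$, and each edge by a straight-line segment. Steiner points may coincide with each other and with terminals (so edges incident to a Steiner point may have length $0$; such edges, and trees containing them, are called degenerate), and edges may cross. A Steiner tree is full if its topology is full. The length $L(T)$ of a tree $T$ is the sum of the Euclidean lengths of its edges. Angles are measured in $[0,\pi]$. For $\varepsilon\geq 0$, an $\varepsilon$-approximate Steiner tree is a tree with a Steiner topology, with all the angles spanned by the edges at each Steiner point belonging to the interval $[2\pi/3-\varepsilon,2\pi/3+\varepsilon]$. For $d\geq 2$, $n\geq 3$ and $\varepsilon\geq 0$, $\mathcal{A}_\varepsilon^d(n)$ denotes the set of all full $\varepsilon$-approximate Steiner trees on $n$ terminals in $\mathbb{R}^d$. For a tree $T$ in $\mathbb{R}^d$ with Steiner topology $\mathcal{T}$, $S(T)$ denotes the (unique) shortest tree in $\mathbb{R}^d$ on the terminals of $T$ with topology $\mathcal{T}$,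 where degenerate shortest trees are allowed. Define \[F_d(\varepsilon,n)=\sup\left\{\frac{L(T)-L(S(T))}{L(S(T))}: T\in\mathcal{A}_\varepsilon^d(n)\right\}.\]
   Formalization: In the plane, the three angles at each Steiner point of an ε-approximate Steiner tree are also required to sum to 2π (automatic if ε<2π/9); otherwise the bound fails, e.g. n=3, ε=π/3, unit edges at angles π/3, π/3, 2π/3: L(T)=3, L(S(T))≤2. *)

theory Defs
  imports "HOL-Analysis.Analysis"
begin

text \<open>
  Finite simple graphs on vertices of type \<^typ>\<open>nat\<close>; edges are two-element sets of vertices.
  The terminals \<open>t\<^sub>1, \<dots>, t\<^sub>n\<close> are the vertices \<open>1, \<dots>, n\<close>, all other vertices are Steiner
  points. Up to renaming of vertices, every topology is of this form.
\<close>

record graph =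
  verts :: "nat set"
  edges :: "nat set set"

definition finite_graph :: "graph \<Rightarrow> bool" where
  "finite_graph G \<longleftrightarrow> finite (verts G) \<and> (\<forall>e\<in>edges G. e \<subseteq> verts G \<and> card e = 2)"

definition nbrs :: "graph \<Rightarrow> nat \<Rightarrow> nat set" where
  "nbrs G v = {u. {v, u} \<in> edges G}"

definition deg :: "graph \<Rightarrow> nat \<Rightarrow> nat" where
  "deg G v = card {e \<in> edges G. v \<in> e}"

definition connected_graph :: "graph \<Rightarrow> bool" where
  "connected_graph G \<longleftrightarrow> verts G \<noteq> {} \<and>
     (\<forall>u\<in>verts G. \<forall>v\<in>verts G. (u, v) \<in> {(a, b). {a, b} \<in> edges G}\<^sup>*)"

definition is_cycle :: "graph \<Rightarrow> nat list \<Rightarrow> bool" where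
  "is_cycle G c \<longleftrightarrow> length c \<ge> 3 \<and> distinct c \<and>
     (\<forall>i<length c. {c ! i, c ! (Suc i mod length c)} \<in> edges G)"

definition is_tree :: "graph \<Rightarrow> bool" where
  "is_tree G \<longleftrightarrow> finite_graph G \<and> connected_graph G \<and> (\<nexists>c. is_cycle G c)"

definition steiner_points :: "nat \<Rightarrow> graph \<Rightarrow> nat set" where
  "steiner_points n G = verts G - {1..n}"

definition steiner_topology :: "nat \<Rightarrow> graph \<Rightarrow> bool" where
  "steiner_topology n G \<longleftrightarrow> is_tree G \<and> {1..n} \<subseteq> verts G \<and>
     (\<forall>t\<in>{1..n}. deg G t \<le> 3) \<and> (\<forall>s\<in>steiner_points n G. deg G s = 3)"

definition full_topology :: "nat \<Rightarrow> graph \<Rightarrow> bool" where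
  "full_topology n G \<longleftrightarrow> steiner_topology n G \<and> (\<forall>t\<in>{1..n}. deg G t = 1)"

text \<open>
  A Steiner tree is a pair of a topology \<open>G\<close> and a map \<open>x\<close> giving the position of each vertex;
  the values of \<open>x\<close> outside \<^term>\<open>verts G\<close> are irrelevant. Each edge is counted once below, as
  the pair of its ends in increasing order.
\<close>

definition tree_length :: "graph \<Rightarrow> (nat \<Rightarrow> 'a::metric_space) \<Rightarrow> real" where
  "tree_length G x = (\<Sum>(u, v)\<in>{(u, v). u < v \<and> {u, v} \<in> edges G}. dist (x u) (x v))"

text \<open>Only meaningful for nonzero vectors; the value lies in \<open>[0, \<pi>]\<close>.\<close>

definition vec_angle :: "'a::real_inner \<Rightarrow> 'a \<Rightarrow> real" where
  "vec_angle u v = arccos (u \<bullet> v / (norm u * norm v))"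

definition edge_angle :: "(nat \<Rightarrow> 'a::real_inner) \<Rightarrow> nat \<Rightarrow> nat \<Rightarrow> nat \<Rightarrow> real" where
  "edge_angle x s u v = vec_angle (x u - x s) (x v - x s)"

text \<open>
  The angles at a Steiner point only make sense if the three edges there have positive length,
  hence the second line. The last line concerns the plane: there the three edges at a Steiner
  point divide the full angle into three angles, each measured in \<open>[0, \<pi>]\<close>, that add up to
  \<open>2\<pi>\<close>. If \<open>\<epsilon> < 2\<pi>/9\<close>, this already follows from the angle bounds, see
  \<open>planar_angles_sum\<close> below. For larger \<open>\<epsilon>\<close> it excludes three edges lying in an open
  half-plane, with one angle the sum of the other two. If these were allowed, the upper bound
  \<open>1 / cos ((n - 2) * \<epsilon> / 2) - 1\<close> for the relative error would fail, e.g. for \<open>n = 3\<close>,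
  \<open>\<epsilon> = \<pi>/3\<close>, three edges of length \<open>1\<close> and angles \<open>\<pi>/3, \<pi>/3, 2\<pi>/3\<close>: the length is \<open>3\<close>,
  moving the Steiner point to the middle terminal gives length \<open>2\<close>, and \<open>3 / 2 > 1 / cos (\<pi>/6)\<close>.
\<close>

definition approx_steiner :: "real \<Rightarrow> nat \<Rightarrow> graph \<Rightarrow> (nat \<Rightarrow> 'a::euclidean_space) \<Rightarrow> bool" where
  "approx_steiner \<epsilon> n G x \<longleftrightarrow> steiner_topology n G \<and> (\<forall>s\<in>steiner_points n G.
     (\<forall>u\<in>nbrs G s. x u \<noteq> x s) \<and>
     (\<forall>u\<in>nbrs G s. \<forall>v\<in>nbrs G s. u \<noteq> v \<longrightarrow>
        edge_angle x s u v \<in> {2 * pi / 3 - \<epsilon> .. 2 * pi / 3 + \<epsilon>}) \<and>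
     (DIM('a) = 2 \<longrightarrow>
        (\<Sum>(u, v)\<in>{(u, v). u < v \<and> u \<in> nbrs G s \<and> v \<in> nbrs G s}. edge_angle x s u v) = 2 * pi))"

text \<open>The set \<open>\<A>\<^sub>\<epsilon>\<^sup>d(n)\<close>, where \<open>d\<close> is the dimension of the type \<^typ>\<open>'a\<close>.\<close>

definition full_approx_trees :: "real \<Rightarrow> nat \<Rightarrow> (graph \<times> (nat \<Rightarrow> 'a::euclidean_space)) set" where
  "full_approx_trees \<epsilon> n = {(G, x). full_topology n G \<and> approx_steiner \<epsilon> n G x}"

text \<open>
  The positions of the vertices in the shortest tree \<open>S(T)\<close>, which is taken over all trees with
  the topology and the terminals of \<open>T\<close>, degenerate ones included. If there are several
  shortest trees, \<^const>\<open>arg_min\<close> selects one; they all have the same length.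
\<close>

definition shortest :: "nat \<Rightarrow> graph \<Rightarrow> (nat \<Rightarrow> 'a::metric_space) \<Rightarrow> nat \<Rightarrow> 'a" where
  "shortest n G x = arg_min (tree_length G) (\<lambda>y. \<forall>i\<in>{1..n}. y i = x i)"

text \<open>
  The supremum is taken in the extended reals, so that it is \<open>\<infinity>\<close> if the ratios are unbounded.
  If \<open>L(S(T)) = 0 < L(T)\<close>, then the ratio is \<open>\<infinity>\<close> too. The type argument is the space.
\<close>

definition F :: "'a::euclidean_space itself \<Rightarrow> real \<Rightarrow> nat \<Rightarrow> ereal" where
  "F _ \<epsilon> n = (SUP (G, x) \<in> (full_approx_trees \<epsilon> n :: (graph \<times> (nat \<Rightarrow> 'a)) set).
     ereal (tree_length G x - tree_length G (shortest n G x)) /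
     ereal (tree_length G (shortest n G x)))"

lemma cos_vec_angle: "cos (vec_angle u v) = u \<bullet> v / (norm u * norm v)"
proof -
  have "\<bar>u \<bullet> v / (norm u * norm v)\<bar> \<le> 1"
    using Cauchy_Schwarz_ineq2[of u v] by (auto simp: abs_mult divide_le_eq_1)
  then show ?thesis by (simp add: vec_angle_def cos_arccos_abs)
qed

lemma vec_angle_bounds: "0 \<le> vec_angle u v" "vec_angle u v \<le> pi"
proof -
  have "\<bar>u \<bullet> v / (norm u * norm v)\<bar> \<le> 1"
    using Cauchy_Schwarz_ineq2[of u v] by (auto simp: abs_mult divide_le_eq_1)
  then show "0 \<le> vec_angle u v" "vec_angle u v \<le> pi"
    unfolding vec_angle_def by (auto intro!: arccos_lbound arccos_ubound simp only: abs_le_iff)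
qed

lemma cos_gram_factor:
  fixes a b c :: real
  shows "1 + 2 * cos a * cos b * cos c - (cos a)\<^sup>2 - (cos b)\<^sup>2 - (cos c)\<^sup>2
    = (cos (b - c) - cos a) * (cos a - cos (b + c))"
proof -
  have "(sin b)\<^sup>2 * (sin c)\<^sup>2 = (1 - (cos b)\<^sup>2) * (1 - (cos c)\<^sup>2)"
    by (simp add: sin_squared_eq)
  then show ?thesis
    unfolding cos_add cos_diff by algebra
qed

lemma planar_angles_sum:
  fixes u v w :: "real^2"
  assumes nz: "u \<noteq> 0" "v \<noteq> 0" "w \<noteq> 0" and eps: "\<epsilon> < 2 * pi / 9"
    and ang: "vec_angle v w \<in> {2 * pi / 3 - \<epsilon> .. 2 * pi / 3 + \<epsilon>}"
      "vec_angle u w \<in> {2 * pi / 3 - \<epsilon> .. 2 * pi / 3 + \<epsilon>}"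
      "vec_angle u v \<in> {2 * pi / 3 - \<epsilon> .. 2 * pi / 3 + \<epsilon>}"
  shows "vec_angle v w + vec_angle u w + vec_angle u v = 2 * pi"
proof -
  define a b c where "a = vec_angle v w" and "b = vec_angle u w" and "c = vec_angle u v"
  have n2: "(norm y)\<^sup>2 = y \<bullet> y" for y :: "real^2" by (simp add: power2_norm_eq_inner)
  define U V W where "U = norm u" and "V = norm v" and "W = norm w"
  have pos: "U > 0" "V > 0" "W > 0" using nz by (auto simp: U_def V_def W_def)
  have vw: "v \<bullet> w = V * W * cos a" and uw: "u \<bullet> w = U * W * cos b" and uv: "u \<bullet> v = U * V * cos c"
    using nz by (auto simp: a_def b_def c_def cos_vec_angle U_def V_def W_def)
  have "(u\<bullet>u) * (v\<bullet>v) * (w\<bullet>w) + 2 * (v\<bullet>w) * (u\<bullet>w) * (u\<bullet>v)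
      - (u\<bullet>u) * (v\<bullet>w)\<^sup>2 - (v\<bullet>v) * (u\<bullet>w)\<^sup>2 - (w\<bullet>w) * (u\<bullet>v)\<^sup>2 = 0"
    unfolding inner_vec_def sum_2 inner_real_def by algebra
  then have "(U * V * W)\<^sup>2 *
      (1 + 2 * cos a * cos b * cos c - (cos a)\<^sup>2 - (cos b)\<^sup>2 - (cos c)\<^sup>2) = 0"
    unfolding vw uw uv n2[symmetric] U_def[symmetric] V_def[symmetric] W_def[symmetric]
    by algebra
  then have "(cos (b - c) - cos a) * (cos a - cos (b + c)) = 0"
    using pos by (simp add: cos_gram_factor)
  then consider "cos \<bar>b - c\<bar> = cos a" | "cos (b + c) = cos a" by force
  moreover have bds: "0 \<le> a" "a \<le> pi" "0 \<le> b" "b \<le> pi" "0 \<le> c" "c \<le> pi"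
    by (simp_all only: a_def b_def c_def vec_angle_bounds)
  moreover have ang': "2 * pi / 3 - \<epsilon> \<le> a" "a \<le> 2 * pi / 3 + \<epsilon>" "2 * pi / 3 - \<epsilon> \<le> b"
    "b \<le> 2 * pi / 3 + \<epsilon>" "2 * pi / 3 - \<epsilon> \<le> c" "c \<le> 2 * pi / 3 + \<epsilon>"
    using ang by (simp_all only: a_def b_def c_def atLeastAtMost_iff)
  ultimately have "a + b + c = 2 * pi"
  proof cases
    case 1
    have "\<bar>b - c\<bar> = a"
      by (rule cos_inj_pi) (use 1 bds in linarith)+
    then show ?thesis using ang' eps by linarith
  next
    case 2
    show ?thesis
    proof (cases "b + c \<le> pi")
      case True
      have "b + c = a"
        by (rule cos_inj_pi) (use True 2 bds in linarith)+
      then show ?thesis using ang' eps by linarith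
    next
      case False
      have eq: "cos (2 * pi - (b + c)) = cos a" using 2 by (simp only: cos_2pi_minus)
      have "2 * pi - (b + c) = a"
        by (rule cos_inj_pi) (use eq False bds in linarith)+
      then show ?thesis by linarith
    qed
  qed
  then show ?thesis by (simp only: a_def b_def c_def)
qed

end

theory Submission
  imports Defs
begin

text \<open>
  The length of the shortest tree is bounded from below by a calibration (a dual certificate).
  Let \<open>T\<close> be the given approximate Steiner tree, with positions \<open>x\<close>. Suppose that every oriented
  edge \<open>(u, v)\<close> carries a vector \<open>f u v = - f v u\<close> of norm at most 1, and that the vectors leaving
  any Steiner point add up to 0. Then the sum of the inner products of \<open>f u v\<close> with \<open>y v - y u\<close>
  over the edges is a lower bound for the length of any tree \<open>y\<close> with the same topology, and by
  summation by parts it depends on the terminals only. If moreover each \<open>f u v\<close> makes an angle of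
  at most \<open>(n - 2) * \<epsilon> / 2\<close> with the edge \<open>x v - x u\<close>, then evaluating this sum at \<open>x\<close> shows
  that every tree with the terminals and the topology of \<open>T\<close> has length at least
  \<open>cos ((n - 2) * \<epsilon> / 2)\<close> times the length of \<open>T\<close> (lemma \<open>calibration\<close>).

  To find such vectors in the plane, identified with the complex numbers, rotate the direction of
  each edge \<open>e\<close> by an angle \<open>- \<delta> e\<close>, such that the three rotated edges at every Steiner point are
  exactly \<open>2\<pi>/3\<close> apart. At a single Steiner point this prescribes the differences of the values
  of \<open>\<delta>\<close> on its three edges; each of these differences is the deviation of one of the angles
  from \<open>2\<pi>/3\<close>, hence is at most \<open>\<epsilon>\<close> (lemma \<open>three_directions\<close>). Since the topology is a tree,
  \<open>\<delta>\<close> can be built up by adding one Steiner point at a time. Each Steiner point enlarges the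
  range of \<open>\<delta>\<close> by at most \<open>\<epsilon>\<close>, and there are \<open>n - 2\<close> of them (lemma \<open>star_potential\<close>). So a
  constant can be subtracted to obtain \<open>\<bar>\<delta> e\<bar> \<le> (n - 2) * \<epsilon> / 2\<close> for all edges.

  Finally, \<^const>\<open>shortest\<close> is defined by choice, so that the existence of a shortest tree is needed
  as well; it follows by compactness (lemma \<open>shortest_on_terminals\<close>).
\<close>

section \<open>Full topologies\<close>

lemma nbrs_sym: "u \<in> nbrs G v \<longleftrightarrow> v \<in> nbrs G u"
  by (simp add: nbrs_def insert_commute)

lemma nbrs_verts:
  assumes "finite_graph G" "u \<in> nbrs G v"
  shows "u \<in> verts G" "v \<in> verts G" "u \<noteq> v"
  using assms by (auto simp: finite_graph_def nbrs_def)

lemma finite_nbrs: "finite_graph G \<Longrightarrow> finite (nbrs G v)"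
  by (rule finite_subset[of _ "verts G"]) (auto intro: nbrs_verts(1) simp: finite_graph_def)

lemma finite_edges: "finite_graph G \<Longrightarrow> finite (edges G)"
  by (rule finite_subset[of _ "Pow (verts G)"]) (auto simp: finite_graph_def)

lemma edge_obtain:
  assumes "finite_graph G" "e \<in> edges G" "s \<in> e"
  obtains a where "e = {s, a}" "a \<in> nbrs G s"
proof -
  have "card e = 2" using assms by (auto simp: finite_graph_def)
  then obtain p q where "e = {p, q}" by (auto simp: card_2_iff)
  then show thesis using assms that[of p] that[of q] by (auto simp: nbrs_def insert_commute)
qed

lemma deg_eq_card_nbrs:
  assumes "finite_graph G"
  shows "deg G v = card (nbrs G v)"
proof -
  have "{e \<in> edges G. v \<in> e} = (\<lambda>u. {v, u}) ` nbrs G v"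
    by (auto elim: edge_obtain[OF assms] simp: nbrs_def)
  moreover have "inj_on (\<lambda>u. {v, u}) (nbrs G v)"
    by (auto simp: inj_on_def doubleton_eq_iff)
  ultimately show ?thesis by (simp add: deg_def card_image)
qed

lemma handshake:
  assumes "finite_graph G"
  shows "(\<Sum>v\<in>verts G. deg G v) = 2 * card (edges G)"
proof -
  have "(\<Sum>v\<in>verts G. card {e \<in> edges G. v \<in> e}) = 2 * card (edges G)"
  proof (rule sum_multicount)
    show "finite (verts G)" using assms by (simp add: finite_graph_def)
    show "finite (edges G)" by (rule finite_edges[OF assms])
    have "{v \<in> verts G. v \<in> e} = e" if "e \<in> edges G" for e
      using assms that by (auto simp: finite_graph_def)
    then show "\<forall>e\<in>edges G. card {v \<in> verts G. v \<in> e} = 2"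
      using assms by (simp add: finite_graph_def)
  qed
  then show ?thesis by (simp add: deg_def)
qed

lemma full_topologyD:
  assumes "full_topology n G"
  shows "finite_graph G" "connected_graph G" "\<not> is_cycle G c" "{1..n} \<subseteq> verts G"
    "t \<in> {1..n} \<Longrightarrow> card (nbrs G t) = 1"
    "s \<in> steiner_points n G \<Longrightarrow> card (nbrs G s) = 3"
proof -
  show fin: "finite_graph G" and "connected_graph G" "\<not> is_cycle G c" "{1..n} \<subseteq> verts G"
    using assms by (auto simp: full_topology_def steiner_topology_def is_tree_def)
  show "t \<in> {1..n} \<Longrightarrow> card (nbrs G t) = 1" "s \<in> steiner_points n G \<Longrightarrow> card (nbrs G s) = 3"
    using assms by (auto simp: full_topology_def steiner_topology_def deg_eq_card_nbrs[OF fin, symmetric])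
qed

lemma connected_closed_set:
  assumes "connected_graph G" "a \<in> A" "a \<in> verts G"
    and closed: "\<And>u v. u \<in> A \<Longrightarrow> v \<in> nbrs G u \<Longrightarrow> v \<in> A"
  shows "verts G \<subseteq> A"
proof
  fix v assume "v \<in> verts G"
  then have "(a, v) \<in> {(a, b). {a, b} \<in> edges G}\<^sup>*"
    using assms by (auto simp: connected_graph_def)
  then show "v \<in> A"
    by induction (use assms(2) closed in \<open>auto simp: nbrs_def\<close>)
qed

lemma no_adjacent_terminals:
  assumes full: "full_topology n G" and n: "n \<ge> 3" and t: "t \<in> {1..n}" "t' \<in> {1..n}"
  shows "t' \<notin> nbrs G t"
proof
  assume adj: "t' \<in> nbrs G t"
  note G = full_topologyD[OF full]
  have "nbrs G t = {t'}" "nbrs G t' = {t}"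
    using G(5)[OF t(1)] G(5)[OF t(2)] adj nbrs_sym[of t' G t] by (auto simp: card_1_singleton_iff)
  then have "verts G \<subseteq> {t, t'}"
    using G(4) t by (intro connected_closed_set[OF G(2), of t]) auto
  then have "card {1..n} \<le> card {t, t'}"
    using G(4) by (intro card_mono) auto
  also have "\<dots> \<le> 2" by (simp add: card_insert_if)
  finally show False using n by simp
qed

text \<open>A path in \<open>G\<close> from \<open>a\<close> to \<open>b\<close> without repeated vertices that stays in \<open>W\<close>.\<close>

definition path_within :: "graph \<Rightarrow> nat set \<Rightarrow> nat \<Rightarrow> nat \<Rightarrow> nat list \<Rightarrow> bool" where
  "path_within G W a b p \<longleftrightarrow> p \<noteq> [] \<and> hd p = a \<and> last p = b \<and> distinct p \<and> set p \<subseteq> W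
     \<and> successively (\<lambda>u v. {u, v} \<in> edges G) p"

text \<open>The subgraph induced by \<open>W\<close> is connected (or empty).\<close>

definition linked :: "graph \<Rightarrow> nat set \<Rightarrow> bool" where
  "linked G W \<longleftrightarrow> (\<forall>a\<in>W. \<forall>b\<in>W. \<exists>p. path_within G W a b p)"

lemma path_within_singleton: "path_within G {s} s s [s]"
  by (simp add: path_within_def)

lemma path_within_mono: "path_within G W a b p \<Longrightarrow> W \<subseteq> W' \<Longrightarrow> path_within G W' a b p"
  by (auto simp: path_within_def)

lemma path_within_rev: "path_within G W a b p \<Longrightarrow> path_within G W b a (rev p)"
  by (simp add: path_within_def hd_rev last_rev insert_commute)

lemma path_within_Cons:
  assumes "path_within G W w b p" "w \<in> nbrs G s" "s \<notin> W"
  shows "path_within G (insert s W) s b (s # p)"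
  using assms by (auto simp: path_within_def successively_Cons nbrs_def)

lemma linked_singleton: "linked G {s}"
  unfolding linked_def using path_within_singleton by blast

lemma linked_insert:
  assumes "linked G W" "w \<in> W" "w \<in> nbrs G s" "s \<notin> W"
  shows "linked G (insert s W)"
proof -
  have from_s: "\<exists>p. path_within G (insert s W) s b p" if "b \<in> W" for b
    using assms that path_within_Cons unfolding linked_def by meson
  then have to_s: "\<exists>p. path_within G (insert s W) b s p" if "b \<in> W" for b
    using that path_within_rev by meson
  have s: "path_within G (insert s W) s s [s]"
    using path_within_mono[OF path_within_singleton] by blast
  have "\<exists>p. path_within G (insert s W) a b p" if "a \<in> W" "b \<in> W" for a b
    using assms(1) that path_within_mono[OF _ subset_insertI] unfolding linked_def by meson
  with from_s to_s s show ?thesis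
    unfolding linked_def by (metis insert_iff)
qed

lemma linked_unique_nbr:
  assumes "\<And>c. \<not> is_cycle G c" and "linked G W" "s \<notin> W"
    and a: "a \<in> W" "a \<in> nbrs G s" and b: "b \<in> W" "b \<in> nbrs G s"
  shows "a = b"
proof (rule ccontr)
  assume "a \<noteq> b"
  let ?E = "\<lambda>u v. {u, v} \<in> edges G"
  obtain p where p: "p \<noteq> []" "hd p = a" "last p = b" "distinct p" "set p \<subseteq> W" "successively ?E p"
    using assms(2) a b unfolding linked_def path_within_def by meson
  let ?c = "s # p"
  have "length p \<noteq> 1"
    using p \<open>a \<noteq> b\<close> by (auto simp: length_Suc_conv)
  then have len: "length ?c \<ge> 3" using p(1) by (cases p) (auto simp: Suc_le_eq)
  have succ: "successively ?E ?c"
    using p a by (auto simp: successively_Cons nbrs_def)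
  have "{?c ! i, ?c ! (Suc i mod length ?c)} \<in> edges G" if i: "i < length ?c" for i
  proof (cases "Suc i = length ?c")
    case True
    then have "?c ! i = b" using p by (auto simp: last_conv_nth nth_Cons')
    then show ?thesis using b True by (simp add: nbrs_def insert_commute)
  next
    case False
    then have "Suc i < length ?c" using i by simp
    then show ?thesis using succ unfolding successively_conv_nth by simp
  qed
  then have "is_cycle G ?c"
    using len p \<open>s \<notin> W\<close> by (auto simp: is_cycle_def)
  then show False using assms(1) by blast
qed

text \<open>
  The Steiner points of a full topology span a tree, so they can be added one at a time, each new
  one having exactly one neighbour among the previous ones.
\<close>

lemma steiner_points_induct [consumes 2, case_names singleton insert]:
  assumes full: "full_topology n G" and n: "n \<ge> 3"
    and base: "\<And>s. s \<in> steiner_points n G \<Longrightarrow> P {s}"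
    and step: "\<And>W s w. \<lbrakk>W \<subseteq> steiner_points n G; s \<in> steiner_points n G; s \<notin> W;
      nbrs G s \<inter> W = {w}; P W\<rbrakk> \<Longrightarrow> P (insert s W)"
  shows "P (steiner_points n G)"
proof -
  let ?S = "steiner_points n G"
  note G = full_topologyD[OF full]
  have finS: "finite ?S" using G(1) by (simp add: finite_graph_def steiner_points_def)
  define Q where "Q W \<longleftrightarrow> W \<subseteq> ?S \<and> W \<noteq> {} \<and> linked G W \<and> P W" for W
  obtain s0 where s0: "s0 \<in> ?S"
  proof -
    have t1: "1 \<in> {1..n}" using n by simp
    from G(5)[OF t1] obtain u where u: "u \<in> nbrs G 1" by (auto simp: card_1_singleton_iff)
    then have "u \<notin> {1..n}" using no_adjacent_terminals[OF full n t1] by blast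
    then show thesis
      using that nbrs_verts(1)[OF G(1) u] by (simp add: steiner_points_def)
  qed
  then have "Q {s0}" by (simp add: Q_def base linked_singleton)
  moreover have "finite {W. Q W}"
    by (rule finite_subset[of _ "Pow ?S"]) (auto simp: Q_def finS)
  ultimately have "\<exists>W\<in>{W. Q W}. \<forall>W'\<in>{W. Q W}. W \<le> W' \<longrightarrow> W = W'"
    using finite_has_maximal[of "{W. Q W}"] by fast
  then obtain W where W: "W \<in> {W. Q W}" "\<forall>W'\<in>{W. Q W}. W \<le> W' \<longrightarrow> W = W'"
    by (rule bexE)
  then have QW: "Q W" by simp
  have max: "W = W'" if "Q W'" "W \<subseteq> W'" for W'
    using W(2)[rule_format, of W'] that by simp
  have no_ext: "s \<in> W" if s: "s \<in> ?S" and w: "w \<in> W" "w \<in> nbrs G s" for s w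
  proof (rule ccontr)
    assume "s \<notin> W"
    have W: "W \<subseteq> ?S" "linked G W" "P W" using QW by (simp_all add: Q_def)
    have "b = w" if "b \<in> W" "b \<in> nbrs G s" for b
      by (rule linked_unique_nbr[OF _ W(2) \<open>s \<notin> W\<close> that w]) (rule G(3))
    then have "nbrs G s \<inter> W = {w}" using w by blast
    then have "P (insert s W)" by (rule step[OF W(1) s \<open>s \<notin> W\<close> _ W(3)])
    moreover have "linked G (insert s W)" by (rule linked_insert[OF W(2) w \<open>s \<notin> W\<close>])
    ultimately have "Q (insert s W)" using W(1) s by (simp add: Q_def)
    then show False using max[of "insert s W"] \<open>s \<notin> W\<close> by blast
  qed
  \<comment> \<open>Together with its adjacent terminals, the maximal set \<open>W\<close> is closed under adjacency.\<close>
  let ?A = "W \<union> {t \<in> {1..n}. nbrs G t \<inter> W \<noteq> {}}"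
  obtain w0 where w0: "w0 \<in> W" using QW by (auto simp: Q_def)
  have "verts G \<subseteq> ?A"
  proof (rule connected_closed_set[OF G(2), of w0])
    show "w0 \<in> ?A" using w0 by simp
    show "w0 \<in> verts G" using w0 QW by (auto simp: Q_def steiner_points_def)
    fix u v assume u: "u \<in> ?A" and v: "v \<in> nbrs G u"
    show "v \<in> ?A"
    proof (cases "u \<in> W")
      case True
      have "v \<in> verts G" by (rule nbrs_verts(1)[OF G(1) v])
      then show ?thesis
        using True v no_ext[of v u] nbrs_sym[of u G v] by (auto simp: steiner_points_def)
    next
      case False
      then have "card (nbrs G u) = 1" "nbrs G u \<inter> W \<noteq> {}" using u G(5) by auto
      then show ?thesis using v by (auto simp: card_1_singleton_iff)
    qed
  qed
  then have "W = ?S" using QW by (auto simp: Q_def steiner_points_def)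
  then show ?thesis using QW by (simp add: Q_def)
qed

lemma edge_meets_steiner_points:
  assumes full: "full_topology n G" and n: "n \<ge> 3" and e: "e \<in> edges G"
  shows "e \<inter> steiner_points n G \<noteq> {}"
proof
  note G = full_topologyD[OF full]
  assume disj: "e \<inter> steiner_points n G = {}"
  have sub: "e \<subseteq> verts G" and "card e = 2" using G(1) e by (auto simp: finite_graph_def)
  then obtain a b where ab: "e = {a, b}" by (auto simp: card_2_iff)
  then have "a \<in> {1..n}" "b \<in> {1..n}" "b \<in> nbrs G a"
    using disj sub e by (auto simp: steiner_points_def nbrs_def)
  then show False using no_adjacent_terminals[OF full n] by blast
qed

lemma new_incident_edges:
  assumes "finite_graph G" "nbrs G s \<inter> W = {w}"
  shows "{e \<in> edges G. e \<inter> insert s W \<noteq> {}} =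
    {e \<in> edges G. e \<inter> W \<noteq> {}} \<union> (\<lambda>a. {s, a}) ` (nbrs G s - {w})"
proof -
  have "e \<in> (\<lambda>a. {s, a}) ` (nbrs G s - {w})" if "e \<in> edges G" "s \<in> e" "e \<inter> W = {}" for e
    using that assms(2) by (elim edge_obtain[OF assms(1)]) auto
  then show ?thesis by (auto simp: nbrs_def)
qed

text \<open>
  Adding Steiner points one at a time shows that there are \<open>2 * s + 1\<close> edges if there are \<open>s\<close>
  Steiner points. Counting the pairs of a vertex and an edge through it then gives
  \<open>n + 3 * s = 2 * (2 * s + 1)\<close>.
\<close>

lemma card_steiner_points:
  assumes full: "full_topology n G" and n: "n \<ge> 3"
  shows "card (steiner_points n G) = n - 2"
proof -
  let ?S = "steiner_points n G"
  note G = full_topologyD[OF full]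
  have finS: "finite ?S" using G(1) by (simp add: finite_graph_def steiner_points_def)
  have finE: "finite (edges G)" by (rule finite_edges[OF G(1)])
  have "card {e \<in> edges G. e \<inter> ?S \<noteq> {}} = 2 * card ?S + 1"
    using full n
  proof (induction rule: steiner_points_induct)
    case (singleton s)
    have "card {e \<in> edges G. e \<inter> {s} \<noteq> {}} = deg G s" by (simp add: deg_def)
    then show ?case using G(6)[OF singleton] by (simp add: deg_eq_card_nbrs[OF G(1)])
  next
    case (insert W s w)
    have disj: "{e \<in> edges G. e \<inter> W \<noteq> {}} \<inter> (\<lambda>a. {s, a}) ` (nbrs G s - {w}) = {}"
      using insert by auto
    have "card ((\<lambda>a. {s, a}) ` (nbrs G s - {w})) = card (nbrs G s - {w})"
      by (intro card_image) (auto simp: inj_on_def doubleton_eq_iff)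
    also have "\<dots> = 2"
      using insert G(6)[of s] by (subst card_Diff_singleton) auto
    finally have "card ((\<lambda>a. {s, a}) ` (nbrs G s - {w})) = 2" .
    moreover have "finite W" using insert finS finite_subset by blast
    ultimately show ?case
      unfolding new_incident_edges[OF G(1) insert(4)]
      using insert finE finite_nbrs[OF G(1)] disj by (subst card_Un_disjoint) auto
  qed
  moreover have "{e \<in> edges G. e \<inter> ?S \<noteq> {}} = edges G"
    using edge_meets_steiner_points[OF full n] by blast
  moreover have "(\<Sum>v\<in>verts G. deg G v) = n + 3 * card ?S"
  proof -
    have V: "verts G = {1..n} \<union> ?S" "{1..n} \<inter> ?S = {}"
      using G(4) by (auto simp: steiner_points_def)
    have "(\<Sum>v\<in>verts G. deg G v) = (\<Sum>v\<in>{1..n}. deg G v) + (\<Sum>v\<in>?S. deg G v)"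
      unfolding V(1) by (rule sum.union_disjoint) (use finS V in auto)
    then show ?thesis using G(5,6) by (simp add: deg_eq_card_nbrs[OF G(1)])
  qed
  ultimately show ?thesis using handshake[OF G(1)] by simp
qed

text \<open>
  If the differences of the values of a function on the edges at each Steiner point \<open>s\<close> are
  prescribed, by means of values \<open>h s a\<close> for the edges \<open>{s, a}\<close>, then such a function exists. If
  the prescribed differences are at most \<open>\<epsilon>\<close>, then its range has length at most \<open>(n - 2) * \<epsilon>\<close>.
\<close>

lemma star_potential:
  fixes h :: "nat \<Rightarrow> nat \<Rightarrow> real"
  assumes full: "full_topology n G" and n: "n \<ge> 3" and \<epsilon>: "\<epsilon> \<ge> 0"
    and h: "\<And>s a b. \<lbrakk>s \<in> steiner_points n G; a \<in> nbrs G s; b \<in> nbrs G s\<rbrakk>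
      \<Longrightarrow> \<bar>h s a - h s b\<bar> \<le> \<epsilon>"
  shows "\<exists>\<delta>. (\<forall>s\<in>steiner_points n G. \<exists>c. \<forall>a\<in>nbrs G s. \<delta> {s, a} = h s a + c) \<and>
    (\<forall>e\<in>edges G. \<forall>e'\<in>edges G. \<bar>\<delta> e - \<delta> e'\<bar> \<le> (real n - 2) * \<epsilon>)"
proof -
  let ?S = "steiner_points n G"
  let ?I = "\<lambda>W. {e \<in> edges G. e \<inter> W \<noteq> {}}"
  note G = full_topologyD[OF full]
  have finS: "finite ?S" using G(1) by (simp add: finite_graph_def steiner_points_def)
  have "\<exists>\<delta>. (\<forall>s\<in>?S. \<exists>c. \<forall>a\<in>nbrs G s. \<delta> {s, a} = h s a + c) \<and>
      (\<forall>e\<in>?I ?S. \<forall>e'\<in>?I ?S. \<bar>\<delta> e - \<delta> e'\<bar> \<le> card ?S * \<epsilon>)"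
    using full n
  proof (induction rule: steiner_points_induct)
    case (singleton s)
    define \<delta> where "\<delta> e = h s (the_elem (e - {s}))" for e
    have val: "\<delta> {s, a} = h s a" if "a \<in> nbrs G s" for a
    proof -
      have "{s, a} - {s} = {a}" using nbrs_verts(3)[OF G(1) that] by auto
      then show ?thesis by (simp add: \<delta>_def)
    qed
    have "\<bar>\<delta> e - \<delta> e'\<bar> \<le> \<epsilon>" if e: "e \<in> ?I {s}" "e' \<in> ?I {s}" for e e'
    proof -
      have "e \<in> edges G" "s \<in> e" and e': "e' \<in> edges G" "s \<in> e'" using e by auto
      then obtain a where "e = {s, a}" "a \<in> nbrs G s" by (elim edge_obtain[OF G(1)])
      moreover from e' obtain a' where "e' = {s, a'}" "a' \<in> nbrs G s"
        by (rule edge_obtain[OF G(1)])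
      ultimately show ?thesis using h[OF singleton] val by simp
    qed
    moreover have "\<exists>c. \<forall>a\<in>nbrs G s. \<delta> {s, a} = h s a + c" using val by (intro exI[of _ 0]) simp
    ultimately show ?case by (intro exI[of _ \<delta>]) simp
  next
    case (insert W s w)
    from insert.IH obtain \<delta> where
      IH: "\<forall>s'\<in>W. \<exists>c. \<forall>a\<in>nbrs G s'. \<delta> {s', a} = h s' a + c"
        "\<forall>e\<in>?I W. \<forall>e'\<in>?I W. \<bar>\<delta> e - \<delta> e'\<bar> \<le> card W * \<epsilon>"
      by (elim exE conjE)
    note \<delta> = IH(1)[THEN bspec] IH(2)[THEN bspec, THEN bspec]
    have w: "w \<in> nbrs G s" "w \<in> W" using insert.hyps by auto
    \<comment> \<open>The edge to \<open>w\<close> already has a value, which fixes the additive constant at \<open>s\<close>.\<close>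
    define c where "c = \<delta> {s, w} - h s w"
    define \<delta>' where "\<delta>' e = (if e \<inter> W \<noteq> {} then \<delta> e else h s (the_elem (e - {s})) + c)" for e
    have old: "\<delta>' e = \<delta> e" if "e \<inter> W \<noteq> {}" for e
      using that by (simp add: \<delta>'_def)
    have new: "\<delta>' {s, a} = h s a + c" if a: "a \<in> nbrs G s" for a
    proof (cases "a = w")
      case True
      then show ?thesis using w old[of "{s, w}"] by (simp add: c_def)
    next
      case False
      then have "a \<notin> W" using a insert.hyps by auto
      moreover have "{s, a} - {s} = {a}" using nbrs_verts(3)[OF G(1) a] by auto
      ultimately show ?thesis using insert.hyps by (simp add: \<delta>'_def)
    qed
    have sw: "{s, w} \<in> ?I W" using w by (auto simp: nbrs_def)
    have mixed: "\<bar>\<delta>' {s, a} - \<delta>' e\<bar> \<le> card W * \<epsilon> + \<epsilon>" if a: "a \<in> nbrs G s" and e: "e \<in> ?I W" for a e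
    proof -
      have "\<delta>' {s, a} - \<delta>' e = (h s a - h s w) + (\<delta> {s, w} - \<delta> e)"
        using new[OF a] old e by (simp add: c_def)
      moreover have "\<bar>h s a - h s w\<bar> \<le> \<epsilon>" using h insert.hyps a w by blast
      moreover have "\<bar>\<delta> {s, w} - \<delta> e\<bar> \<le> card W * \<epsilon>" using \<delta>(2) sw e by blast
      ultimately show ?thesis by linarith
    qed
    have nonneg: "card W * \<epsilon> \<ge> 0" using \<epsilon> by simp
    have "finite W" using insert.hyps finS finite_subset by blast
    then have card: "card (insert s W) * \<epsilon> = card W * \<epsilon> + \<epsilon>"
      using insert.hyps by (simp add: algebra_simps)
    have range: "\<bar>\<delta>' e - \<delta>' e'\<bar> \<le> card (insert s W) * \<epsilon>"
      if e: "e \<in> ?I (insert s W)" and e': "e' \<in> ?I (insert s W)" for e e'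
    proof -
      have split: "e \<in> ?I W \<or> (\<exists>a\<in>nbrs G s. e = {s, a})" if "e \<in> ?I (insert s W)" for e
        using that unfolding new_incident_edges[OF G(1) insert.hyps(4)] by blast
      from split[OF e] split[OF e'] consider
        "e \<in> ?I W" "e' \<in> ?I W"
        | a where "e' \<in> ?I W" "a \<in> nbrs G s" "e = {s, a}"
        | a where "e \<in> ?I W" "a \<in> nbrs G s" "e' = {s, a}"
        | a a' where "a \<in> nbrs G s" "e = {s, a}" "a' \<in> nbrs G s" "e' = {s, a'}"
        by blast
      then show ?thesis unfolding card
      proof cases
        case 1
        then have "\<delta>' e = \<delta> e" "\<delta>' e' = \<delta> e'" "\<bar>\<delta> e - \<delta> e'\<bar> \<le> card W * \<epsilon>" using old \<delta>(2) by auto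
        then show "\<bar>\<delta>' e - \<delta>' e'\<bar> \<le> card W * \<epsilon> + \<epsilon>" using \<epsilon> by simp
      next
        case 2
        then show "\<bar>\<delta>' e - \<delta>' e'\<bar> \<le> card W * \<epsilon> + \<epsilon>" using mixed by blast
      next
        case 3
        then show "\<bar>\<delta>' e - \<delta>' e'\<bar> \<le> card W * \<epsilon> + \<epsilon>" using mixed[of a e] by (simp add: abs_minus_commute)
      next
        case 4
        then have "\<bar>\<delta>' e - \<delta>' e'\<bar> \<le> \<epsilon>" using h[OF insert.hyps(2)] new by simp
        then show "\<bar>\<delta>' e - \<delta>' e'\<bar> \<le> card W * \<epsilon> + \<epsilon>" using nonneg by linarith
      qed
    qed
    have "\<exists>c. \<forall>a\<in>nbrs G s'. \<delta>' {s', a} = h s' a + c" if s': "s' \<in> insert s W" for s'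
    proof (cases "s' = s")
      case True
      then show ?thesis using new by blast
    next
      case False
      then show ?thesis using s' \<delta>(1)[of s'] old by simp
    qed
    then show ?case using range by (intro exI[of _ \<delta>'] conjI ballI)
  qed
  moreover have "?I ?S = edges G"
    using edge_meets_steiner_points[OF full n] by blast
  moreover have "real (card ?S) = real n - 2"
    using card_steiner_points[OF full n] n by simp
  ultimately show ?thesis by simp
qed

section \<open>Calibrations\<close>

lemma finite_oriented_edges:
  assumes "finite_graph G"
  shows "finite {(u, v). u < v \<and> {u, v} \<in> edges G}"
proof (rule finite_subset)
  show "{(u, v). u < v \<and> {u, v} \<in> edges G} \<subseteq> verts G \<times> verts G"
    using assms by (auto simp: finite_graph_def)
  show "finite (verts G \<times> verts G)" using assms by (simp add: finite_graph_def)
qed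

lemma sum_by_parts:
  fixes f :: "nat \<Rightarrow> nat \<Rightarrow> 'a::real_inner"
  assumes G: "finite_graph G" and anti: "\<And>u v. f v u = - f u v"
  shows "(\<Sum>(u, v)\<in>{(u, v). u < v \<and> {u, v} \<in> edges G}. f u v \<bullet> (z v - z u)) =
    - (\<Sum>u\<in>verts G. (\<Sum>v\<in>nbrs G u. f u v) \<bullet> z u)"
proof -
  let ?E = "{(u, v). u < v \<and> {u, v} \<in> edges G}"
  let ?E' = "{(u, v). v < u \<and> {u, v} \<in> edges G}"
  let ?g = "\<lambda>(u, v). f u v \<bullet> z u"
  have fin: "finite ?E" by (rule finite_oriented_edges[OF G])
  have E': "?E' = prod.swap ` ?E" by (auto simp: image_iff insert_commute)
  have "sum ?g ?E' = (\<Sum>(u, v)\<in>?E. f v u \<bullet> z v)"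
    unfolding E' by (subst sum.reindex) (auto simp: case_prod_unfold)
  then have "(\<Sum>(u, v)\<in>?E. f u v \<bullet> (z v - z u)) = - (sum ?g ?E + sum ?g ?E')"
    by (simp add: case_prod_unfold sum.distrib[symmetric] sum_negf[symmetric] inner_diff_right
        anti[of "fst _" "snd _"] algebra_simps)
  also have "sum ?g ?E + sum ?g ?E' = sum ?g (?E \<union> ?E')"
    using fin by (subst sum.union_disjoint) (auto simp: E')
  also have "?E \<union> ?E' = {(u, v). v \<in> nbrs G u}"
    using nbrs_verts(3)[OF G] by (auto simp: nbrs_def neq_iff)
  also have "\<dots> = Sigma (verts G) (nbrs G)"
    using nbrs_verts(2)[OF G] by auto
  also have "sum ?g \<dots> = (\<Sum>u\<in>verts G. \<Sum>v\<in>nbrs G u. f u v \<bullet> z u)"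
    using G by (subst sum.Sigma) (auto simp: finite_nbrs finite_graph_def)
  finally show ?thesis by (simp add: inner_sum_left)
qed

text \<open>
  The vectors \<open>f u v\<close> certify a lower bound for the length of any \<open>y\<close> with the same graph that
  agrees with \<open>x\<close> on \<open>A\<close>. By summation by parts, the sum of the inner products is the same for
  \<open>x\<close> and for \<open>y\<close>.
\<close>

lemma calibration:
  fixes f :: "nat \<Rightarrow> nat \<Rightarrow> 'a::real_inner"
  assumes G: "finite_graph G" and anti: "\<And>u v. f v u = - f u v" and le1: "\<And>u v. norm (f u v) \<le> 1"
    and balanced: "\<And>s. s \<in> verts G - A \<Longrightarrow> (\<Sum>v\<in>nbrs G s. f s v) = 0"
    and \<kappa>: "\<And>u v. {u, v} \<in> edges G \<Longrightarrow> \<kappa> * dist (x u) (x v) \<le> f u v \<bullet> (x v - x u)"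
    and agree: "\<And>t. t \<in> A \<Longrightarrow> y t = x t"
  shows "\<kappa> * tree_length G x \<le> tree_length G y"
proof -
  let ?E = "{(u, v). u < v \<and> {u, v} \<in> edges G}"
  have "\<kappa> * tree_length G x = (\<Sum>(u, v)\<in>?E. \<kappa> * dist (x u) (x v))"
    by (simp add: tree_length_def sum_distrib_left case_prod_unfold)
  also have "\<dots> \<le> (\<Sum>(u, v)\<in>?E. f u v \<bullet> (x v - x u))"
    by (rule sum_mono) (auto intro: \<kappa>)
  also have "\<dots> = (\<Sum>(u, v)\<in>?E. f u v \<bullet> (y v - y u))"
    unfolding sum_by_parts[OF G anti]
    using balanced agree by (intro arg_cong[where f = uminus] sum.cong) (auto, force)
  also have "\<dots> \<le> (\<Sum>(u, v)\<in>?E. dist (y u) (y v))"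
  proof (rule sum_mono, clarify)
    fix u v
    have "f u v \<bullet> (y v - y u) \<le> norm (f u v) * norm (y v - y u)" by (rule norm_cauchy_schwarz)
    also have "\<dots> \<le> 1 * norm (y v - y u)" by (intro mult_right_mono le1) simp
    finally show "f u v \<bullet> (y v - y u) \<le> dist (y u) (y v)" by (simp add: dist_norm norm_minus_commute)
  qed
  finally show ?thesis by (simp add: tree_length_def)
qed

section \<open>Angles in the complex plane\<close>

lemma unit_complex_eq_cis:
  assumes "norm z = 1" "Re z = cos \<alpha>"
  shows "z = cis \<alpha> \<or> z = cis (- \<alpha>)"
proof -
  have "(Re z)\<^sup>2 + (Im z)\<^sup>2 = 1" using assms(1) by (simp add: cmod_power2[symmetric])
  then have "(Im z)\<^sup>2 = (sin \<alpha>)\<^sup>2" using assms(2) by (simp add: sin_squared_eq)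
  then have "Im z = sin \<alpha> \<or> Im z = - sin \<alpha>" by (simp add: power2_eq_iff)
  then show ?thesis using assms(2) by (auto simp: complex_eq_iff)
qed

lemma sgn_ratio_vec_angle:
  fixes p q :: complex
  assumes "p \<noteq> 0" "q \<noteq> 0"
  shows "norm (sgn q / sgn p) = 1" "Re (sgn q / sgn p) = cos (vec_angle p q)"
proof -
  show "norm (sgn q / sgn p) = 1" using assms by (simp add: norm_divide norm_sgn)
  have "sgn q / sgn p = sgn q * cnj (sgn p)"
    by (subst complex_div_cnj) (use assms in \<open>simp add: norm_sgn\<close>)
  also have "Re \<dots> = sgn p \<bullet> sgn q" by (simp add: inner_complex_def mult.commute)
  also have "\<dots> = cos (vec_angle p q)"
    unfolding cos_vec_angle by (simp add: sgn_div_norm divide_inverse)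
  finally show "Re (sgn q / sgn p) = cos (vec_angle p q)" .
qed

text \<open>
  Three directions that divide the full angle into three angles of at most \<open>\<pi>\<close> can be turned into
  directions that are \<open>2\<pi>/3\<close> apart by keeping the first and rotating the others by the deviations of
  their angles from \<open>2\<pi>/3\<close>. The sign \<open>\<sigma>\<close> in the proof is the orientation of the three directions.
\<close>

lemma three_directions:
  fixes p q r :: complex
  assumes nz: "p \<noteq> 0" "q \<noteq> 0" "r \<noteq> 0"
    and full_angle: "vec_angle p q + vec_angle p r + vec_angle q r = 2 * pi"
  obtains h k where "sgn p + sgn q * cis (- h) + sgn r * cis (- k) = 0"
    "\<bar>h\<bar> = \<bar>vec_angle p q - 2 * pi / 3\<bar>" "\<bar>k\<bar> = \<bar>vec_angle p r - 2 * pi / 3\<bar>"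
    "\<bar>h - k\<bar> = \<bar>vec_angle q r - 2 * pi / 3\<bar>"
proof -
  define \<alpha> \<beta> \<gamma> where "\<alpha> = vec_angle p q" and "\<beta> = vec_angle p r" and "\<gamma> = vec_angle q r"
  define z z' where "z = sgn q / sgn p" and "z' = sgn r / sgn p"
  have z: "z = cis \<alpha> \<or> z = cis (- \<alpha>)" and z': "z' = cis \<beta> \<or> z' = cis (- \<beta>)"
    using unit_complex_eq_cis sgn_ratio_vec_angle nz by (simp_all add: z_def z'_def \<alpha>_def \<beta>_def)
  have "z' / z = sgn r / sgn q" using nz by (simp add: z_def z'_def sgn_zero_iff)
  then have "Re (z' / z) = cos \<gamma>" using sgn_ratio_vec_angle nz by (simp add: \<gamma>_def)
  moreover have "cos \<gamma> = cos (\<alpha> + \<beta>)"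
  proof -
    have "\<gamma> = 2 * pi - (\<alpha> + \<beta>)" using full_angle by (simp add: \<alpha>_def \<beta>_def \<gamma>_def)
    then show ?thesis by (simp only: cos_2pi_minus)
  qed
  ultimately have re: "Re (z' / z) = cos (\<alpha> + \<beta>)" by simp
  obtain \<sigma> :: real where \<sigma>: "\<sigma> = 1 \<or> \<sigma> = - 1" "z = cis (\<sigma> * \<alpha>)" "z' = cis (- (\<sigma> * \<beta>))"
  proof -
    \<comment> \<open>If \<open>q\<close> and \<open>r\<close> are turned away from \<open>p\<close> in the same sense, then one of them is a positive
      or negative multiple of \<open>p\<close>, and the sense of its rotation is arbitrary.\<close>
    have degenerate: "cis \<alpha> = cis (- \<alpha>) \<or> cis \<beta> = cis (- \<beta>)" if "cos (\<beta> - \<alpha>) = cos (\<alpha> + \<beta>)"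
      using that by (auto simp: cos_add cos_diff complex_eq_iff)
    from z z' consider "z = cis \<alpha>" "z' = cis (- \<beta>)" | "z = cis (- \<alpha>)" "z' = cis \<beta>"
      | "z = cis \<alpha>" "z' = cis \<beta>" | "z = cis (- \<alpha>)" "z' = cis (- \<beta>)" by blast
    then show thesis
    proof cases
      case 1
      then show ?thesis using that[of 1] by simp
    next
      case 2
      then show ?thesis using that[of "- 1"] by simp
    next
      case 3
      then have "cos (\<beta> - \<alpha>) = cos (\<alpha> + \<beta>)" using re by (simp add: cis_divide)
      then show ?thesis using degenerate 3 that[of 1] that[of "- 1"] by auto
    next
      case 4
      then have "cos (\<beta> - \<alpha>) = cos (\<alpha> + \<beta>)"
        using re cos_minus[of "\<beta> - \<alpha>"] by (simp add: cis_divide)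
      then show ?thesis using degenerate 4 that[of 1] that[of "- 1"] by auto
    qed
  qed
  define h k where "h = \<sigma> * (\<alpha> - 2 * pi / 3)" and "k = - (\<sigma> * (\<beta> - 2 * pi / 3))"
  have "z * cis (- h) = cis (\<sigma> * (2 * pi / 3))" "z' * cis (- k) = cis (- (\<sigma> * (2 * pi / 3)))"
    by (simp_all add: \<sigma>(2,3) cis_mult h_def k_def algebra_simps)
  moreover have "1 + cis (\<sigma> * (2 * pi / 3)) + cis (- (\<sigma> * (2 * pi / 3))) = 0"
    using \<sigma>(1) by (auto simp: complex_eq_iff cos_120)
  ultimately have "1 + z * cis (- h) + z' * cis (- k) = 0" by simp
  then have "sgn p * (1 + z * cis (- h) + z' * cis (- k)) = 0" by simp
  then have 1: "sgn p + sgn q * cis (- h) + sgn r * cis (- k) = 0"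
    using nz by (simp add: z_def z'_def sgn_zero_iff algebra_simps)
  have 2: "\<bar>h\<bar> = \<bar>\<alpha> - 2 * pi / 3\<bar>" "\<bar>k\<bar> = \<bar>\<beta> - 2 * pi / 3\<bar>"
    using \<sigma>(1) by (auto simp: h_def k_def)
  have "\<gamma> = 2 * pi - \<alpha> - \<beta>" using full_angle by (simp add: \<alpha>_def \<beta>_def \<gamma>_def)
  moreover have "h - k = \<sigma> * (2 * pi / 3 - (2 * pi - \<alpha> - \<beta>))"
    by (simp add: h_def k_def algebra_simps)
  ultimately have "h - k = \<sigma> * (2 * pi / 3 - \<gamma>)" by simp
  then have "\<bar>h - k\<bar> = \<bar>\<gamma> - 2 * pi / 3\<bar>"
    using \<sigma>(1) by auto
  with 1 2 show thesis using that by (simp add: \<alpha>_def \<beta>_def \<gamma>_def)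
qed

lemma card_3_increasing:
  fixes A :: "nat set"
  assumes "card A = 3"
  obtains a b c where "a < b" "b < c" "A = {a, b, c}"
proof -
  define xs where "xs = sorted_list_of_set A"
  have "finite A" using assms by (intro card_ge_0_finite) simp
  then have xs: "length xs = 3" "sorted_wrt (<) xs" "set xs = A"
    using assms by (simp_all add: xs_def)
  then obtain a b c where "xs = [a, b, c]" by (auto simp: numeral_3_eq_3 length_Suc_conv)
  then show thesis using xs that[of a b c] by simp
qed

text \<open>
  Rotating the edge from the Steiner point \<open>s\<close> to \<open>a\<close> by \<open>- h a\<close> makes the directions at \<open>s\<close> add
  up to 0.
\<close>

lemma steiner_point_rotations:
  fixes x :: "nat \<Rightarrow> complex"
  assumes T: "approx_steiner \<epsilon> n G x" "full_topology n G" and \<epsilon>: "\<epsilon> \<ge> 0"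
    and s: "s \<in> steiner_points n G"
  shows "\<exists>h. (\<Sum>a\<in>nbrs G s. sgn (x a - x s) * cis (- h a)) = 0 \<and>
    (\<forall>a\<in>nbrs G s. \<forall>b\<in>nbrs G s. \<bar>h a - h b\<bar> \<le> \<epsilon>)"
proof -
  obtain a b c where abc: "a < b" "b < c" "nbrs G s = {a, b, c}"
    using card_3_increasing[OF full_topologyD(6)[OF T(2) s]] .
  let ?p = "\<lambda>u. x u - x s"
  have nz: "?p a \<noteq> 0" "?p b \<noteq> 0" "?p c \<noteq> 0"
    and ang: "\<bar>vec_angle (?p a) (?p b) - 2 * pi / 3\<bar> \<le> \<epsilon>"
      "\<bar>vec_angle (?p a) (?p c) - 2 * pi / 3\<bar> \<le> \<epsilon>" "\<bar>vec_angle (?p b) (?p c) - 2 * pi / 3\<bar> \<le> \<epsilon>"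
    using T(1) s abc unfolding approx_steiner_def edge_angle_def by (auto simp: abs_le_iff)
  have pairs: "{(u, v). u < v \<and> u \<in> nbrs G s \<and> v \<in> nbrs G s} = {(a, b), (a, c), (b, c)}"
    using abc by auto
  have "(\<Sum>(u, v)\<in>{(u, v). u < v \<and> u \<in> nbrs G s \<and> v \<in> nbrs G s}. edge_angle x s u v) = 2 * pi"
    using T(1) s unfolding approx_steiner_def by simp
  then have "vec_angle (?p a) (?p b) + vec_angle (?p a) (?p c) + vec_angle (?p b) (?p c) = 2 * pi"
    unfolding pairs edge_angle_def using abc by simp
  from three_directions[OF nz this] obtain h k where
    hk: "sgn (?p a) + sgn (?p b) * cis (- h) + sgn (?p c) * cis (- k) = 0"
      "\<bar>h\<bar> \<le> \<epsilon>" "\<bar>k\<bar> \<le> \<epsilon>" "\<bar>h - k\<bar> \<le> \<epsilon>"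
    using ang by metis
  define g where "g = (\<lambda>_. 0)(b := h, c := k)"
  have g: "g a = 0" "g b = h" "g c = k" using abc by (auto simp: g_def)
  have "(\<Sum>u\<in>nbrs G s. sgn (?p u) * cis (- g u)) = 0"
    using hk(1) g abc by (simp add: add.assoc)
  moreover have "\<forall>u\<in>nbrs G s. \<forall>v\<in>nbrs G s. \<bar>g u - g v\<bar> \<le> \<epsilon>"
    using hk \<epsilon> g abc by (auto simp: abs_minus_commute)
  ultimately show ?thesis by blast
qed

lemma midpoint_of_range:
  fixes g :: "'b \<Rightarrow> real"
  assumes "finite A" and "\<And>a b. a \<in> A \<Longrightarrow> b \<in> A \<Longrightarrow> \<bar>g a - g b\<bar> \<le> D"
  shows "\<exists>m. \<forall>a\<in>A. \<bar>g a - m\<bar> \<le> D / 2"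
proof (cases "A = {}")
  case False
  let ?M = "Max (g ` A)" and ?m = "Min (g ` A)"
  have "?M \<in> g ` A" "?m \<in> g ` A" using False assms(1) by (auto intro: Max_in Min_in)
  then have "?M - ?m \<le> D" using assms(2) by (fastforce simp: abs_le_iff)
  moreover have "g a \<le> ?M" "?m \<le> g a" if "a \<in> A" for a using that assms(1) by auto
  ultimately have "\<bar>g a - (?M + ?m) / 2\<bar> \<le> D / 2" if "a \<in> A" for a
    using that by (force simp: abs_le_iff field_simps)
  then show ?thesis by blast
qed simp

lemma approx_steiner_length_complex:
  fixes x y :: "nat \<Rightarrow> complex"
  assumes T: "approx_steiner \<epsilon> n G x" and full: "full_topology n G" and n: "n \<ge> 3" and \<epsilon>: "\<epsilon> \<ge> 0"
    and small: "(real n - 2) * \<epsilon> / 2 \<le> pi"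
    and agree: "\<And>t. t \<in> {1..n} \<Longrightarrow> y t = x t"
  shows "cos ((real n - 2) * \<epsilon> / 2) * tree_length G x \<le> tree_length G y"
proof -
  let ?S = "steiner_points n G"
  let ?D = "(real n - 2) * \<epsilon>"
  note G = full_topologyD[OF full]
  obtain h where h: "\<And>s. s \<in> ?S \<Longrightarrow> (\<Sum>a\<in>nbrs G s. sgn (x a - x s) * cis (- h s a)) = 0"
    "\<And>s a b. s \<in> ?S \<Longrightarrow> a \<in> nbrs G s \<Longrightarrow> b \<in> nbrs G s \<Longrightarrow> \<bar>h s a - h s b\<bar> \<le> \<epsilon>"
    using steiner_point_rotations[OF T full \<epsilon>] by metis
  have "\<exists>\<delta>. (\<forall>s\<in>?S. \<exists>c. \<forall>a\<in>nbrs G s. \<delta> {s, a} = h s a + c) \<and>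
      (\<forall>e\<in>edges G. \<forall>e'\<in>edges G. \<bar>\<delta> e - \<delta> e'\<bar> \<le> ?D)"
    by (rule star_potential[where h = h, OF full n \<epsilon> h(2)])
  then obtain \<delta> where \<delta>: "\<forall>s\<in>?S. \<exists>c. \<forall>a\<in>nbrs G s. \<delta> {s, a} = h s a + c"
    "\<forall>e\<in>edges G. \<forall>e'\<in>edges G. \<bar>\<delta> e - \<delta> e'\<bar> \<le> ?D"
    by (elim exE conjE)
  have "\<exists>m. \<forall>e\<in>edges G. \<bar>\<delta> e - m\<bar> \<le> ?D / 2"
    by (rule midpoint_of_range[where g = \<delta>, OF finite_edges[OF G(1)] \<delta>(2)[THEN bspec, THEN bspec]])
  then obtain m where m: "\<And>e. e \<in> edges G \<Longrightarrow> \<bar>\<delta> e - m\<bar> \<le> ?D / 2" by blast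
  define f where "f u v = sgn (x v - x u) * cis (m - \<delta> {u, v})" for u v
  show ?thesis
  proof (rule calibration[where f = f and A = "{1..n}", OF G(1) _ _ _ _ agree])
    show "f v u = - f u v" for u v
      using sgn_minus[of "x v - x u"] by (simp add: f_def insert_commute)
    show "norm (f u v) \<le> 1" for u v
      by (simp add: f_def norm_mult norm_sgn)
    show "(\<Sum>v\<in>nbrs G s. f s v) = 0" if "s \<in> verts G - {1..n}" for s
    proof -
      have s: "s \<in> ?S" using that by (simp add: steiner_points_def)
      then obtain c where c: "\<forall>a\<in>nbrs G s. \<delta> {s, a} = h s a + c" using \<delta>(1) by blast
      have "(\<Sum>v\<in>nbrs G s. f s v) = (\<Sum>a\<in>nbrs G s. sgn (x a - x s) * cis (- h s a) * cis (m - c))"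
        by (rule sum.cong) (use c in \<open>auto simp: f_def cis_mult mult.assoc algebra_simps\<close>)
      also have "\<dots> = 0" using h(1)[OF s] by (simp add: sum_distrib_right[symmetric])
      finally show ?thesis .
    qed
    show "cos (?D / 2) * dist (x u) (x v) \<le> f u v \<bullet> (x v - x u)" if e: "{u, v} \<in> edges G" for u v
    proof -
      have inner: "(sgn w * cis t) \<bullet> w = cos t * norm w" for w :: complex and t
      proof -
        have "(sgn w * cis t) \<bullet> w = cos t * (sgn w \<bullet> w)"
          by (simp add: inner_complex_def sgn_div_norm algebra_simps)
        also have "sgn w \<bullet> w = norm w"
          by (cases "w = 0") (simp_all add: sgn_div_norm dot_square_norm power2_eq_square)
        finally show ?thesis .
      qed
      have "cos (?D / 2) \<le> cos \<bar>m - \<delta> {u, v}\<bar>"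
        using m[OF e] small by (intro cos_monotone_0_pi_le) (auto simp: abs_minus_commute)
      then show ?thesis
        by (simp add: f_def inner dist_norm norm_minus_commute[of "x u"] mult_right_mono)
    qed
  qed
qed

section \<open>The plane and the existence of shortest trees\<close>

lemma approx_steiner_length:
  fixes x y :: "nat \<Rightarrow> real^2"
  assumes T: "approx_steiner \<epsilon> n G x" and full: "full_topology n G" and n: "n \<ge> 3" and \<epsilon>: "\<epsilon> \<ge> 0"
    and small: "(real n - 2) * \<epsilon> / 2 \<le> pi"
    and agree: "\<And>t. t \<in> {1..n} \<Longrightarrow> y t = x t"
  shows "cos ((real n - 2) * \<epsilon> / 2) * tree_length G x \<le> tree_length G y"
proof -
  define \<phi> :: "real^2 \<Rightarrow> complex" where "\<phi> v = Complex (v $ 1) (v $ 2)" for v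
  have diff: "\<phi> u - \<phi> v = \<phi> (u - v)" for u v by (simp add: \<phi>_def complex_eq_iff)
  have inner: "\<phi> u \<bullet> \<phi> v = u \<bullet> v" for u v
    by (simp add: \<phi>_def inner_complex_def inner_vec_def sum_2)
  have norm: "norm (\<phi> v) = norm v" for v by (simp add: norm_eq_sqrt_inner inner)
  have dist: "dist (\<phi> u) (\<phi> v) = dist u v" for u v by (simp add: dist_norm diff norm)
  have inj: "\<phi> u = \<phi> v \<longleftrightarrow> u = v" for u v using dist[of u v] by (metis dist_eq_0_iff)
  have len: "tree_length G (\<phi> \<circ> z) = tree_length G z" for z by (simp add: tree_length_def dist)
  have ang: "edge_angle (\<phi> \<circ> x) = edge_angle x"
    by (intro ext) (simp add: edge_angle_def vec_angle_def diff inner norm)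
  have "approx_steiner \<epsilon> n G (\<phi> \<circ> x)"
    using T by (simp add: approx_steiner_def ang inj)
  from approx_steiner_length_complex[OF this full n \<epsilon> small, of "\<phi> \<circ> y"] show ?thesis
    using agree by (simp add: len)
qed

text \<open>
  The content of this lemma is that the minimum in the definition of \<^const>\<open>shortest\<close> is attained;
  otherwise nothing would be known about the selected positions.
\<close>

lemma shortest_on_terminals:
  fixes x :: "nat \<Rightarrow> 'a::euclidean_space"
  assumes G: "finite_graph G"
  shows "\<forall>i\<in>{1..n}. shortest n G x i = x i"
proof -
  obtain R where R: "\<And>i. i \<in> {1..n} \<Longrightarrow> norm (x i) \<le> R" and R0: "R \<ge> 0"
  proof -
    have "\<exists>R>0. \<forall>v\<in>x ` {1..n}. norm v \<le> R"
      using finite_imp_bounded[of "x ` {1..n}"] by (simp add: bounded_pos)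
    then obtain R where "R > 0" "\<forall>v\<in>x ` {1..n}. norm v \<le> R" by blast
    then show thesis using that[of R] by simp
  qed
  let ?K = "\<lambda>i. if i \<in> {1..n} then {x i} else cball 0 R"
  let ?C = "PiE UNIV ?K"
  have "compact ?C"
  proof -
    have "compactin (product_topology (\<lambda>i. euclidean) UNIV) ?C"
      by (subst compactin_PiE) auto
    then show ?thesis
      by (simp only: euclidean_product_topology compactin_euclidean_iff)
  qed
  moreover have "?C \<noteq> {}" using R0 by (auto simp: PiE_eq_empty_iff split: if_splits)
  moreover have "continuous_on ?C (tree_length G)"
    unfolding tree_length_def case_prod_unfold
    by (intro continuous_intros continuous_on_product_coordinates[THEN continuous_on_subset]) auto
  ultimately obtain y where y: "y \<in> ?C" and min: "\<And>z. z \<in> ?C \<Longrightarrow> tree_length G y \<le> tree_length G z"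
    using continuous_attains_inf[of ?C "tree_length G"] by blast
  have yx: "\<forall>i\<in>{1..n}. y i = x i" using y by (auto simp: PiE_iff split: if_splits)
  have "tree_length G y \<le> tree_length G z" if z: "\<forall>i\<in>{1..n}. z i = x i" for z
  proof -
    \<comment> \<open>Projecting onto a ball that contains the terminals does not increase distances.\<close>
    define z' where "z' = closest_point (cball 0 R) \<circ> z"
    have ball: "closed (cball (0::'a) R)" "cball (0::'a) R \<noteq> {}" using R0 by auto
    have "norm (closest_point (cball 0 R) v) \<le> R" for v :: 'a
      using closest_point_in_set[OF ball, of v] by simp
    then have "z' \<in> ?C"
      using z R by (auto simp: z'_def PiE_iff closest_point_self)
    then have "tree_length G y \<le> tree_length G z'" by (rule min)
    also have "\<dots> \<le> tree_length G z"
      unfolding tree_length_def z'_def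
      using closest_point_lipschitz[OF convex_cball ball] by (auto intro!: sum_mono)
    finally show ?thesis .
  qed
  then have "is_arg_min (tree_length G) (\<lambda>y. \<forall>i\<in>{1..n}. y i = x i) y"
    using yx by (simp add: is_arg_min_linorder)
  then have "is_arg_min (tree_length G) (\<lambda>y. \<forall>i\<in>{1..n}. y i = x i) (shortest n G x)"
    unfolding shortest_def arg_min_def by (rule someI[of "is_arg_min _ _"])
  then show ?thesis by (simp add: is_arg_min_def)
qed

theorem theorem4p1:
  fixes n :: nat and \<epsilon> :: real
  assumes "n \<ge> 3" and "0 < \<epsilon>" and "\<epsilon> < pi / (real n - 2)"
  shows "F TYPE(real^2) \<epsilon> n \<le> ereal (1 / cos ((real n - 2) * \<epsilon> / 2) - 1)"
proof -
  define \<kappa> where "\<kappa> = cos ((real n - 2) * \<epsilon> / 2)"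
  have "(real n - 2) * \<epsilon> < pi" using assms by (simp add: field_simps)
  moreover have "(real n - 2) * \<epsilon> \<ge> 0" using assms by simp
  ultimately have half: "0 \<le> (real n - 2) * \<epsilon> / 2" "(real n - 2) * \<epsilon> / 2 < pi / 2"
    "(real n - 2) * \<epsilon> / 2 \<le> pi" by auto
  then have \<kappa>: "\<kappa> > 0" "\<kappa> \<le> 1"
    unfolding \<kappa>_def by (auto intro!: cos_gt_zero_pi)
  have "ereal (tree_length G x - tree_length G (shortest n G x)) / ereal (tree_length G (shortest n G x))
      \<le> ereal (1 / \<kappa> - 1)"
    if "full_topology n G" "approx_steiner \<epsilon> n G x" for G and x :: "nat \<Rightarrow> real^2"
  proof -
    let ?L = "tree_length G x" and ?M = "tree_length G (shortest n G x)"
    have fin: "finite_graph G" using full_topologyD(1)[OF that(1)] .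
    have le: "\<kappa> * ?L \<le> ?M"
      unfolding \<kappa>_def
      by (rule approx_steiner_length[OF that(2,1)])
        (use assms half shortest_on_terminals[OF fin, of n x] in auto)
    have nonneg: "?L \<ge> 0" "?M \<ge> 0" by (auto simp: tree_length_def intro!: sum_nonneg)
    show ?thesis
    proof (cases "?M = 0")
      case True
      \<comment> \<open>Here the ratio is \<open>0 / 0\<close>, which is 0 in the extended reals.\<close>
      then have "?L = 0" using le \<kappa> nonneg by (simp add: mult_le_0_iff)
      then show ?thesis using True \<kappa> by (simp add: zero_ereal_def[symmetric])
    next
      case False
      then have "?M > 0" using nonneg by simp
      then have "(?L - ?M) / ?M \<le> 1 / \<kappa> - 1" using le \<kappa> by (simp add: field_simps)
      then show ?thesis using False by simp
    qed
  qed
  then show ?thesis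
    unfolding F_def full_approx_trees_def \<kappa>_def[symmetric] by (intro SUP_least) auto
qed

end
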